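(* Let $n\ge 1$, let $W>0$ be a knapsack capacity, and for each item $i\in\{1,\dots,n\}$ let $w_i\in\mathbb{N}_{>0}$ with $w_i\le W$ and $a_i,b_i\in\mathbb{Z}$, with parametric profit $p_i(\lambda)=a_i+\lambda b_i$ for $\lambda\in\mathbb{R}$. Let $\varphi:\mathbb{R}\to\mathbb{R}$ be the function defined in the context below, and let $\varepsilon\in(0,1)$. For $\lambda$ with $\varphi(\lambda)>0$ define the scaled profit $$\widetilde{p}_i(\lambda)=\left\lfloor \frac{n\cdot p_i(\lambda)}{\varepsilon\cdot\varphi(\lambda)}\right\rfloor .$$ Then for each item $i\in\{1,\dots,n\}$, as $\lambda$ increases from $-\infty$ to $+\infty$, the scaled profit $\widetilde{p}_i(\lambda)$ attains each value in $\{0,1,\dots,\lfloor 2n/\varepsilon\rfloor\}$ at most three times; that is, for each such value $v$, the set $\{\lambda\in\mathbb{R}:\varphi(\lambda)>0,\ \widetilde p_i(\lambda)=v\}$ is a union of at most three intervals.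
   Context: Definition of $\varphi$ (parametric greedy $\tfrac12$-approximation, smoothed). For a fixed $\lambda$, the greedy algorithm sorts the items in non-increasing order of the ratios $p_i(\lambda)/w_i$ and packs the items in this order until the next item $k$ (with $k\ge 2$) would violate the capacity $W$ (or no items are left), giving a feasible 0/1 solution $x'$. The ordering of the items by these ratios is constant on each of the finitely many ($\mathcal{O}(n^2)$) maximal intervals of $\lambda$ between consecutive values at which two ratio functions $p_i(\lambda)/w_i$ intersect; on each such interval the greedy solution $x'$ is fixed, and its profit $\sum_i p_i(\lambda)x'_i$ is an affine function $p^{(j)}(\lambda)=\alpha^{(j)}+\lambda\beta^{(j)}$. Let $S$ be the set consisting of all these affine functions $p^{(j)}$, the zero function $p^{(0)}(\lambda)=0$, and the item profit functions $p_1,\dots,p_n$. Then $\varphi(\lambda)=\max_{f\in S} f(\lambda)$ is the upper envelope of $S$; it is convex, continuous and piecewise linear, and satisfies $\tfrac12 p^*(\lambda)\le\varphi(\lambda)\le p^*(\lambda)$ for all $\lambda$, where $p^*(\lambda)=\max\{\sum_i p_i(\lambda)x_i:\sum_i w_ix_i\le W,\ x\in\{0,1\}^n\}$. *)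

theory Defs
  imports "HOL-Analysis.Analysis"
begin

definition profit :: "(nat \<Rightarrow> int) \<Rightarrow> (nat \<Rightarrow> int) \<Rightarrow> nat \<Rightarrow> real \<Rightarrow> real" where
  "profit a b i l = of_int (a i) + l * of_int (b i)"

definition ratio :: "(nat \<Rightarrow> nat) \<Rightarrow> (nat \<Rightarrow> int) \<Rightarrow> (nat \<Rightarrow> int) \<Rightarrow> nat \<Rightarrow> real \<Rightarrow> real" where
  "ratio w a b i l = profit a b i l / real (w i)"

text \<open>Parameter values at which two distinct ratio functions intersect. Pairs of items with
  identical ratio functions contribute nothing.\<close>

definition breakpoints :: "nat \<Rightarrow> (nat \<Rightarrow> nat) \<Rightarrow> (nat \<Rightarrow> int) \<Rightarrow> (nat \<Rightarrow> int) \<Rightarrow> real set" where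
  "breakpoints n w a b =
     {l. \<exists>i\<in>{1..n}. \<exists>j\<in>{1..n}. ratio w a b i \<noteq> ratio w a b j \<and> ratio w a b i l = ratio w a b j l}"

text \<open>The sorting step of the greedy algorithm does not prescribe how items with identical ratio
  functions are ordered relative to each other. The predicate admits every choice that is constant
  on each interval between consecutive breakpoints. The values of \<open>\<sigma>\<close> at the breakpoints
  themselves are irrelevant.\<close>

definition greedy_ordering ::
    "nat \<Rightarrow> (nat \<Rightarrow> nat) \<Rightarrow> (nat \<Rightarrow> int) \<Rightarrow> (nat \<Rightarrow> int) \<Rightarrow> (real \<Rightarrow> nat list) \<Rightarrow> bool" where
  "greedy_ordering n w a b \<sigma> \<longleftrightarrow>
     (\<forall>l. l \<notin> breakpoints n w a b \<longrightarrow>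
        distinct (\<sigma> l) \<and> set (\<sigma> l) = {1..n} \<and>
        sorted_wrt (\<lambda>i j. ratio w a b i l \<ge> ratio w a b j l) (\<sigma> l)) \<and>
     (\<forall>l m. l \<le> m \<and> {l..m} \<inter> breakpoints n w a b = {} \<longrightarrow> \<sigma> l = \<sigma> m)"

text \<open>The argument \<open>c\<close> is the remaining capacity. Packing stops at the first item that does not fit;
  later items are not tried.\<close>

fun greedy_pack :: "(nat \<Rightarrow> nat) \<Rightarrow> real \<Rightarrow> nat list \<Rightarrow> nat set" where
  "greedy_pack w c [] = {}"
| "greedy_pack w c (k # ks) =
     (if real (w k) \<le> c then insert k (greedy_pack w (c - real (w k)) ks) else {})"

definition greedy_functions ::
    "nat \<Rightarrow> real \<Rightarrow> (nat \<Rightarrow> nat) \<Rightarrow> (nat \<Rightarrow> int) \<Rightarrow> (nat \<Rightarrow> int) \<Rightarrow> (real \<Rightarrow> nat list)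
      \<Rightarrow> (real \<Rightarrow> real) set" where
  "greedy_functions n W w a b \<sigma> =
     {(\<lambda>l. \<Sum>i\<in>greedy_pack w W (\<sigma> m). profit a b i l) | m. m \<notin> breakpoints n w a b}"

definition envelope_functions ::
    "nat \<Rightarrow> real \<Rightarrow> (nat \<Rightarrow> nat) \<Rightarrow> (nat \<Rightarrow> int) \<Rightarrow> (nat \<Rightarrow> int) \<Rightarrow> (real \<Rightarrow> nat list)
      \<Rightarrow> (real \<Rightarrow> real) set" where
  "envelope_functions n W w a b \<sigma> =
     greedy_functions n W w a b \<sigma> \<union> {\<lambda>l. 0} \<union> profit a b ` {1..n}"

definition phi ::
    "nat \<Rightarrow> real \<Rightarrow> (nat \<Rightarrow> nat) \<Rightarrow> (nat \<Rightarrow> int) \<Rightarrow> (nat \<Rightarrow> int) \<Rightarrow> (real \<Rightarrow> nat list)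
      \<Rightarrow> real \<Rightarrow> real" where
  "phi n W w a b \<sigma> l = Max ((\<lambda>f. f l) ` envelope_functions n W w a b \<sigma>)"

definition scaled_profit ::
    "nat \<Rightarrow> real \<Rightarrow> (nat \<Rightarrow> nat) \<Rightarrow> (nat \<Rightarrow> int) \<Rightarrow> (nat \<Rightarrow> int) \<Rightarrow> (real \<Rightarrow> nat list)
      \<Rightarrow> real \<Rightarrow> nat \<Rightarrow> real \<Rightarrow> int" where
  "scaled_profit n W w a b \<sigma> \<epsilon> i l =
     \<lfloor>real n * profit a b i l / (\<epsilon> * phi n W w a b \<sigma> l)\<rfloor>"

lemma greedy_pack_subset: "greedy_pack w c xs \<subseteq> set xs"
  by (induction xs arbitrary: c) auto

text \<open>The maximum defining \<open>phi\<close> is over a finite set.\<close>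

lemma finite_envelope_functions:
  assumes "greedy_ordering n w a b \<sigma>"
  shows "finite (envelope_functions n W w a b \<sigma>)"
proof -
  have "greedy_functions n W w a b \<sigma> \<subseteq> (\<lambda>A l. \<Sum>i\<in>A. profit a b i l) ` Pow {1..n}"
  proof
    fix f assume "f \<in> greedy_functions n W w a b \<sigma>"
    then obtain m where m: "m \<notin> breakpoints n w a b"
      and f: "f = (\<lambda>l. \<Sum>i\<in>greedy_pack w W (\<sigma> m). profit a b i l)"
      by (auto simp: greedy_functions_def)
    have "set (\<sigma> m) = {1..n}"
      using assms m by (simp add: greedy_ordering_def)
    then have "greedy_pack w W (\<sigma> m) \<in> Pow {1..n}"
      using greedy_pack_subset[of w W "\<sigma> m"] by simp
    then show "f \<in> (\<lambda>A l. \<Sum>i\<in>A. profit a b i l) ` Pow {1..n}"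
      using f by blast
  qed
  then have "finite (greedy_functions n W w a b \<sigma>)"
    by (rule finite_subset) simp
  then show ?thesis
    by (simp add: envelope_functions_def)
qed

text \<open>Breaking ties by index gives a greedy ordering, so the predicate is satisfiable.\<close>

lemma ratio_le_between_breakpoints:
  assumes "l \<le> m" and nb: "{l..m} \<inter> breakpoints n w a b = {}"
    and ij: "i \<in> {1..n}" "j \<in> {1..n}"
  shows "ratio w a b i l \<le> ratio w a b j l \<longleftrightarrow> ratio w a b i m \<le> ratio w a b j m"
proof (cases "ratio w a b i = ratio w a b j")
  case False
  define g where "g x = ratio w a b i x - ratio w a b j x" for x
  have nz: "g x \<noteq> 0" if "x \<in> {l..m}" for x
  proof
    assume "g x = 0"
    then have "x \<in> breakpoints n w a b"
      using False ij unfolding breakpoints_def g_def by force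
    then show False
      using nb that by blast
  qed
  have cont: "continuous_on {l..m} g"
    unfolding g_def ratio_def profit_def divide_inverse by (intro continuous_intros)
  have "\<not> (g l \<le> 0 \<and> 0 \<le> g m)"
    using IVT'[of g l 0 m] cont nz \<open>l \<le> m\<close> by (meson atLeastAtMost_iff)
  moreover have "\<not> (g m \<le> 0 \<and> 0 \<le> g l)"
    using IVT2'[of g m 0 l] cont nz \<open>l \<le> m\<close> by (meson atLeastAtMost_iff)
  ultimately show ?thesis
    unfolding g_def by linarith
qed simp

lemma insort_key_cong_le:
  assumes "\<And>y. y \<in> set xs \<Longrightarrow> f x \<le> f y \<longleftrightarrow> g x \<le> g y"
  shows "insort_key f x xs = insort_key g x xs"
  using assms by (induction xs) auto

lemma sort_key_cong_le:
  assumes "\<And>x y. x \<in> set xs \<Longrightarrow> y \<in> set xs \<Longrightarrow> f x \<le> f y \<longleftrightarrow> g x \<le> g y"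
  shows "sort_key f xs = sort_key g xs"
  using assms
proof (induction xs)
  case (Cons x xs)
  then have "sort_key f xs = sort_key g xs" by simp
  moreover have "insort_key f x (sort_key g xs) = insort_key g x (sort_key g xs)"
    using Cons.prems by (intro insort_key_cong_le) simp
  ultimately show ?case by simp
qed simp

lemma greedy_ordering_exists:
  "greedy_ordering n w a b (\<lambda>l. sort_key (\<lambda>i. - ratio w a b i l) [1..<Suc n])"
  unfolding greedy_ordering_def
proof (intro conjI allI impI)
  fix l
  show "distinct (sort_key (\<lambda>i. - ratio w a b i l) [1..<Suc n])"
    by (simp del: upt_Suc)
  show "set (sort_key (\<lambda>i. - ratio w a b i l) [1..<Suc n]) = {1..n}"
    by (auto simp del: upt_Suc)
  show "sorted_wrt (\<lambda>i j. ratio w a b i l \<ge> ratio w a b j l)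
          (sort_key (\<lambda>i. - ratio w a b i l) [1..<Suc n])"
    using sorted_sort_key[of "\<lambda>i. - ratio w a b i l" "[1..<Suc n]"]
    by (simp add: sorted_map del: upt_Suc)
next
  fix l m
  assume "l \<le> m \<and> {l..m} \<inter> breakpoints n w a b = {}"
  then show "sort_key (\<lambda>i. - ratio w a b i l) [1..<Suc n] =
             sort_key (\<lambda>i. - ratio w a b i m) [1..<Suc n]"
    using ratio_le_between_breakpoints[of l m n w a b]
    by (intro sort_key_cong_le) (simp del: upt_Suc)
qed

end

theory Submission
  imports Defs
begin

text \<open>For \<open>v \<ge> 0\<close> the condition \<open>\<lfloor>n p\<^sub>i / (\<epsilon> \<phi>)\<rfloor> = v\<close> together with \<open>\<phi> > 0\<close> says that
  \<open>v \<epsilon> \<phi> - n p\<^sub>i \<le> 0\<close>, while neither \<open>(v + 1) \<epsilon> \<phi> - n p\<^sub>i \<le> 0\<close> nor \<open>\<phi> \<le> 0\<close>. Since \<open>\<phi>\<close> is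
  convex and \<open>p\<^sub>i\<close> is affine, each of these three conditions describes an interval, and removing two
  intervals from an interval leaves at most three intervals.\<close>

text \<open>The complement of an interval \<open>X\<close> consists of its strict lower bounds
  \<open>L X\<close> and its strict upper bounds \<open>U X\<close>. Removing two intervals thus
  gives four pieces, and one of the two mixed pieces is always redundant.\<close>

lemma is_interval_Diff_Diff:
  fixes A B C :: "real set"
  assumes A: "is_interval A" and B: "is_interval B" and C: "is_interval C"
  shows "\<exists>\<J>. finite \<J> \<and> card \<J> \<le> 3 \<and> (\<forall>J\<in>\<J>. is_interval J) \<and> A - B - C = \<Union>\<J>"
proof -
  define L where "L X = {x. \<forall>y\<in>X. x < y}" for X :: "real set"
  define U where "U X = {x. \<forall>y\<in>X. y < x}" for X :: "real set"
  have L: "is_interval (L X)" and U: "is_interval (U X)" for X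
    unfolding is_interval_1 L_def U_def by (auto intro: le_less_trans less_le_trans)
  have compl: "- X = L X \<union> U X" if "is_interval X" for X
  proof
    show "- X \<subseteq> L X \<union> U X"
    proof (rule ccontr)
      assume "\<not> - X \<subseteq> L X \<union> U X"
      then obtain x y z where "x \<notin> X" "y \<in> X" "y \<le> x" "z \<in> X" "x \<le> z"
        unfolding L_def U_def subset_iff Un_iff Compl_iff mem_Collect_eq by (meson not_less)
      then show False
        using that unfolding is_interval_1 by blast
    qed
  qed (auto simp: L_def U_def)
  define LL LU UL UU where "LL = A \<inter> L B \<inter> L C" and "LU = A \<inter> L B \<inter> U C"
    and "UL = A \<inter> U B \<inter> L C" and "UU = A \<inter> U B \<inter> U C"
  have int: "is_interval LL" "is_interval LU" "is_interval UL" "is_interval UU"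
    unfolding LL_def LU_def UL_def UU_def by (intro is_interval_Int A L U)+
  have "A - B - C = A \<inter> - B \<inter> - C"
    by blast
  then have eq: "A - B - C = LL \<union> LU \<union> UL \<union> UU"
    unfolding compl[OF B] compl[OF C] LL_def LU_def UL_def UU_def by blast
  \<comment> \<open>A point between \<open>C\<close> and \<open>B\<close> forces \<open>C\<close> to lie to the left of \<open>B\<close>, so the two middle pieces
    can coexist only if \<open>B\<close> or \<open>C\<close> is empty, and then two of the four pieces coincide.\<close>
  have "B = {} \<or> C = {} \<or> LU = {} \<or> UL = {}"
  proof (rule ccontr)
    assume "\<not> ?thesis"
    then obtain y z s t where "y \<in> B" "z \<in> C" "s \<in> LU" "t \<in> UL"
      by blast
    then have "z < s" "s < y" "y < t" "t < z"
      by (simp_all add: LU_def UL_def L_def U_def)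
    then show False
      by linarith
  qed
  then consider "B = {}" | "C = {}" | "LU = {}" | "UL = {}"
    by blast
  then have "LU \<subseteq> UU \<or> UL \<subseteq> UU"
  proof cases
    case 1
    then show ?thesis by (simp add: LU_def UU_def L_def U_def)
  next
    case 2
    then show ?thesis by (simp add: UL_def UU_def L_def U_def)
  qed auto
  then show ?thesis
  proof
    assume "LU \<subseteq> UU"
    then show ?thesis
      using eq int by (intro exI[of _ "{LL, UL, UU}"]) (auto simp: card_insert_if)
  next
    assume "UL \<subseteq> UU"
    then show ?thesis
      using eq int by (intro exI[of _ "{LL, LU, UU}"]) (auto simp: card_insert_if)
  qed
qed

lemma affine_envelope_functions:
  assumes "f \<in> envelope_functions n W w a b \<sigma>"
  obtains \<alpha> \<beta> where "\<And>l. f l = \<alpha> + \<beta> * l"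
proof -
  have "\<exists>\<alpha> \<beta>. \<forall>l. f l = \<alpha> + \<beta> * l"
    using assms unfolding envelope_functions_def
  proof (elim UnE)
    assume "f \<in> greedy_functions n W w a b \<sigma>"
    then obtain A where f: "f = (\<lambda>l. \<Sum>i\<in>A. profit a b i l)"
      unfolding greedy_functions_def by blast
    have "f l = (\<Sum>i\<in>A. of_int (a i)) + (\<Sum>i\<in>A. of_int (b i)) * l" for l
      by (simp add: f profit_def sum.distrib sum_distrib_left mult.commute)
    then show ?thesis
      by blast
  next
    assume "f \<in> {\<lambda>l. 0}"
    then show ?thesis
      by (intro exI[of _ 0]) auto
  next
    assume "f \<in> profit a b ` {1..n}"
    then obtain i where "f = profit a b i"
      by blast
    then have "f l = of_int (a i) + of_int (b i) * l" for l
      by (simp add: profit_def mult.commute)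
    then show ?thesis
      by blast
  qed
  then show ?thesis
    using that by blast
qed

text \<open>For \<open>k \<ge> 0\<close> an upper bound on \<open>k\<close> times a maximum is the
  same bound on each member, so the set is an intersection of convex sets, one for each affine
  function of the envelope.\<close>

lemma is_interval_phi_le_affine:
  assumes "greedy_ordering n w a b \<sigma>" and "k \<ge> 0"
  shows "is_interval {l. k * phi n W w a b \<sigma> l \<le> \<gamma> + \<delta> * l}"
proof -
  let ?S = "envelope_functions n W w a b \<sigma>"
  have fin: "finite ?S"
    by (rule finite_envelope_functions[OF assms(1)])
  have ne: "?S \<noteq> {}"
    by (simp add: envelope_functions_def)
  have "k * phi n W w a b \<sigma> l \<le> r \<longleftrightarrow> (\<forall>f\<in>?S. k * f l \<le> r)" for l r
  proof
    assume le: "k * phi n W w a b \<sigma> l \<le> r"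
    have "f l \<le> phi n W w a b \<sigma> l" if "f \<in> ?S" for f
      unfolding phi_def using fin that by (intro Max_ge) auto
    then show "\<forall>f\<in>?S. k * f l \<le> r"
      using le assms(2) by (meson mult_left_mono order_trans)
  next
    assume "\<forall>f\<in>?S. k * f l \<le> r"
    \<comment> \<open>The finite maximum is attained, so the bound for the attaining function is the
      bound for \<open>phi\<close>.\<close>
    moreover have "phi n W w a b \<sigma> l \<in> (\<lambda>f. f l) ` ?S"
      unfolding phi_def using fin ne by (intro Max_in) auto
    ultimately show "k * phi n W w a b \<sigma> l \<le> r"
      by auto
  qed
  then have eq: "{l. k * phi n W w a b \<sigma> l \<le> \<gamma> + \<delta> * l} = (\<Inter>f\<in>?S. {l. k * f l \<le> \<gamma> + \<delta> * l})"
    by auto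
  have "convex {l. k * f l \<le> \<gamma> + \<delta> * l}" if "f \<in> ?S" for f
  proof -
    obtain \<alpha> \<beta> where "\<And>l. f l = \<alpha> + \<beta> * l"
      using affine_envelope_functions \<open>f \<in> ?S\<close> by metis
    \<comment> \<open>On the reals \<open>inner\<close> is multiplication. The half-space form also
      covers slope zero, where the set is empty or the whole line.\<close>
    then have "{l. k * f l \<le> \<gamma> + \<delta> * l} = {l. inner (k * \<beta> - \<delta>) l \<le> \<gamma> - k * \<alpha>}"
      by (auto simp: algebra_simps)
    then show ?thesis
      by (simp only: convex_halfspace_le)
  qed
  then show ?thesis
    unfolding eq is_interval_convex_1 by (intro convex_INT)
qed

theorem theorem1:
  fixes n :: nat and W \<epsilon> :: real
    and w :: "nat \<Rightarrow> nat" and a b :: "nat \<Rightarrow> int"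
    and \<sigma> :: "real \<Rightarrow> nat list"
  assumes "n \<ge> 1"
    and "W > 0"
    and "\<And>i. i \<in> {1..n} \<Longrightarrow> w i > 0"
    and "\<And>i. i \<in> {1..n} \<Longrightarrow> real (w i) \<le> W"
    and "greedy_ordering n w a b \<sigma>"
    and "0 < \<epsilon>" and "\<epsilon> < 1"
  shows "\<forall>i\<in>{1..n}. \<forall>v\<in>{0..\<lfloor>2 * real n / \<epsilon>\<rfloor>}.
           \<exists>\<J> :: real set set. finite \<J> \<and> card \<J> \<le> 3 \<and> (\<forall>J\<in>\<J>. is_interval J) \<and>
             {l. phi n W w a b \<sigma> l > 0 \<and> scaled_profit n W w a b \<sigma> \<epsilon> i l = v} = \<Union>\<J>"
proof (intro ballI)
  fix i v
  assume v: "v \<in> {0..\<lfloor>2 * real n / \<epsilon>\<rfloor>}"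
  let ?\<phi> = "phi n W w a b \<sigma>"
  \<comment> \<open>This is \<open>k \<le> n p / (\<epsilon> \<phi>)\<close> with the denominator
    cleared, which is an equivalence only where \<open>\<phi>\<close> is positive; \<open>Z\<close>
    removes all other points.\<close>
  define D where "D k = {l. (of_int k * \<epsilon>) * ?\<phi> l \<le> real n * of_int (a i) + (real n * of_int (b i)) * l}"
    for k :: int
  \<comment> \<open>The coefficients 1 and 0 only bring \<open>\<phi> \<le> 0\<close> into the shape
    of \<open>is_interval_phi_le_affine\<close>.\<close>
  define Z where "Z = {l. 1 * ?\<phi> l \<le> 0 + 0 * l}"
  have D: "is_interval (D k)" if "k \<ge> 0" for k
    unfolding D_def using that \<open>0 < \<epsilon>\<close> by (intro is_interval_phi_le_affine[OF assms(5)]) simp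
  have Z: "is_interval Z"
    unfolding Z_def by (intro is_interval_phi_le_affine[OF assms(5)]) simp
  have D_iff: "l \<in> D k \<longleftrightarrow> of_int k \<le> real n * profit a b i l / (\<epsilon> * ?\<phi> l)" if "?\<phi> l > 0" for l k
    using that \<open>0 < \<epsilon>\<close> by (simp add: D_def profit_def pos_le_divide_eq algebra_simps)
  \<comment> \<open>A floor equals \<open>v\<close> iff its argument is at least \<open>v\<close>
    but not at least \<open>v + 1\<close>; where \<open>\<phi> \<le> 0\<close> both sides are
    false.\<close>
  have "?\<phi> l > 0 \<and> scaled_profit n W w a b \<sigma> \<epsilon> i l = v \<longleftrightarrow> l \<in> D v - D (v + 1) - Z" for l
  proof (cases "?\<phi> l > 0")
    case True
    then have "l \<notin> Z"
      by (simp add: Z_def)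
    then show ?thesis
      using True by (simp add: D_iff scaled_profit_def floor_eq_iff not_le)
  qed (simp add: Z_def)
  then have "{l. ?\<phi> l > 0 \<and> scaled_profit n W w a b \<sigma> \<epsilon> i l = v} = D v - D (v + 1) - Z"
    by blast
  then show "\<exists>\<J> :: real set set. finite \<J> \<and> card \<J> \<le> 3 \<and> (\<forall>J\<in>\<J>. is_interval J) \<and>
      {l. ?\<phi> l > 0 \<and> scaled_profit n W w a b \<sigma> \<epsilon> i l = v} = \<Union>\<J>"
    using is_interval_Diff_Diff[OF D D Z, of v "v + 1"] v by simp
qed

end
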